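(* For all integers $m\ge 0$ and $k\ge 0$, \begin{multline*} r_{2m,k} = \delta_{1,m}\delta_{0,k}+ \sum_{i=0}^{\lfloor \frac m2 \rfloor}(-1)^i\binom{m-i}{i} \binom{m-2i;3}{k-2i} -\sum_{i=0}^{\lfloor \frac{m-1}{2} \rfloor}(-1)^i\binom{m-i-1}{i}\binom{m-2i-1;3}{k-2i}\\ +\sum_{i=0}^{\lfloor \frac{m-2}{2} \rfloor}(-1)^i\binom{m-i-2}{i}\binom{m-2i-2;3}{k-2i} \end{multline*} and \begin{multline*} r_{2m+1,k} = \sum_{i=0}^{\lfloor\frac{m}{2}\rfloor} (-1)^i \binom{m-i}{i}\left(\binom{m-2i;3}{k-2i}+ \binom{m-2i;3}{k-2i-1}\right) \\ -\sum_{i=0}^{\lfloor\frac{m-1}{2} \rfloor} (-1)^i \binom{m-i-1}{i}\left(\binom{m-2i-1;3}{k-2i-1} +\binom{m-2i-1;3}{k-2i-2}\right). \end{multline*}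
   Context: For $n\ge 0$, the $S$-fence $\phi_n$ is the poset on $\{x_1,\dots,x_n\}$ whose order is generated by the cover relations $x_2<x_1$, $x_3<x_2$, $x_2<x_4$, $x_5<x_4$, and, for every $i\ge 3$, $x_{2i-1}<x_{2i}$ and $x_{2i+1}<x_{2i}$, keeping only those relations whose elements both have index $\le n$ ($\phi_0$ is empty). A filter is an up-set. $\mathcal{F}(\phi_n)$ is the set of filters of $\phi_n$ ordered by reverse inclusion; the rank of a filter $Y$ is $n-|Y|$, and $r_{n,k}$ is the number of elements of rank $k$ in $\mathcal{F}(\phi_n)$. For integers $N\ge 0$ and $k$, $\binom{N;3}{k}$ denotes the coefficient of $x^k$ in $(1+x+x^2)^N$ (it equals $0$ for $k<0$), equivalently $\sum_{i=0}^{\lfloor k/2\rfloor}\binom{N}{k-i}\binom{k-i}{i}$ for $k\ge0$. $\delta$ is the Kronecker delta; a sum whose upper limit is smaller than its lower limit is $0$; $\binom{a}{b}=0$ unless $0\le b\le a$. *)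

theory Defs
  imports Complex_Main "HOL-Computational_Algebra.Polynomial"
begin

text \<open>
  The element \<open>x\<^sub>i\<close> of the S-fence is represented by its index \<open>i\<close>; a pair \<open>(a, b)\<close> stands for
  \<open>x\<^sub>a < x\<^sub>b\<close> in the generating relations and for \<open>x\<^sub>a \<le> x\<^sub>b\<close> in the order.
\<close>

definition S_fence_gen :: "(nat \<times> nat) set" where
  "S_fence_gen = {(2, 1), (3, 2), (2, 4), (5, 4)}
     \<union> {(2 * i - 1, 2 * i) | i. 3 \<le> i} \<union> {(2 * i + 1, 2 * i) | i. 3 \<le> i}"

definition S_fence_cover :: "nat \<Rightarrow> (nat \<times> nat) set" where
  "S_fence_cover n = S_fence_gen \<inter> ({1..n} \<times> {1..n})"

text \<open>The closure of type \<^typ>\<open>(nat \<times> nat) set\<close> is reflexive on all of \<^typ>\<open>nat\<close>, hence the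
  second restriction to the carrier.\<close>

definition S_fence_order :: "nat \<Rightarrow> (nat \<times> nat) set" where
  "S_fence_order n = (S_fence_cover n)\<^sup>* \<inter> ({1..n} \<times> {1..n})"

lemma S_fence_order_partial_order: "partial_order_on {1..n} (S_fence_order n)"
proof -
  define h :: "nat \<Rightarrow> nat" where
    "h = (\<lambda>x. if x = 1 then 2 else if x = 2 then 1 else if even x then 2 else 0)"
  have step: "h a < h b" if "(a, b) \<in> S_fence_cover n" for a b
    using that unfolding S_fence_cover_def S_fence_gen_def h_def by auto
  have le: "a = b \<or> h a < h b" if "(a, b) \<in> (S_fence_cover n)\<^sup>*" for a b
    using that by (induction rule: rtrancl_induct) (auto dest: step)
  have "refl_on {1..n} (S_fence_order n)" "S_fence_order n \<subseteq> {1..n} \<times> {1..n}"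
    unfolding refl_on_def S_fence_order_def by auto
  moreover have "trans (S_fence_order n)"
    unfolding trans_def S_fence_order_def by (auto intro: rtrancl_trans)
  moreover have "antisym (S_fence_order n)"
    unfolding antisym_def S_fence_order_def by (auto dest!: le)
  ultimately show ?thesis
    unfolding partial_order_on_def preorder_on_def by auto
qed

definition S_fence_filters :: "nat \<Rightarrow> nat set set" where
  "S_fence_filters n =
     {Y. Y \<subseteq> {1..n} \<and> (\<forall>a b. a \<in> Y \<longrightarrow> (a, b) \<in> S_fence_order n \<longrightarrow> b \<in> Y)}"

text \<open>Filters are ordered by reverse inclusion, so the bottom element is the full set \<open>{1..n}\<close>,
  of rank 0, and the top element is the empty filter, of rank \<open>n\<close>.\<close>

definition filter_le :: "nat \<Rightarrow> (nat set \<times> nat set) set" where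
  "filter_le n = {(Y, Z). Y \<in> S_fence_filters n \<and> Z \<in> S_fence_filters n \<and> Z \<subseteq> Y}"

definition filter_rank :: "nat \<Rightarrow> nat set \<Rightarrow> nat" where
  "filter_rank n Y = n - card Y"

definition rank_number :: "nat \<Rightarrow> nat \<Rightarrow> nat" where
  "rank_number n k = card {Y \<in> S_fence_filters n. filter_rank n Y = k}"

definition trinomial :: "nat \<Rightarrow> int \<Rightarrow> int" where
  "trinomial N k = (if k < 0 then 0 else coeff ([:1, 1, 1:] ^ N) (nat k))"

end

theory Submission
  imports Defs
begin

text \<open>
  The generating function \<open>R\<^sub>n\<close> of the rank numbers satisfies, for \<open>n \<ge> 5\<close>, the recurrence
  \<open>R\<^sub>n = R\<^sub>n\<^sub>-\<^sub>2 + x R\<^sub>n\<^sub>-\<^sub>1\<close> (\<open>n\<close> odd) or \<open>R\<^sub>n = R\<^sub>n\<^sub>-\<^sub>1 + x\<^sup>2 R\<^sub>n\<^sub>-\<^sub>2\<close> (\<open>n\<close> even),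
  by asking whether a filter of \<open>\<phi>\<^sub>n\<close> contains \<open>x\<^sub>n\<close>.
  The alternating sums of trinomial coefficients are the coefficients of the Chebyshev-like
  polynomials \<open>A\<^sub>m\<close> (\<open>cheb m\<close> below) with \<open>A\<^sub>m\<^sub>+\<^sub>2 = (1 + x + x\<^sup>2) A\<^sub>m\<^sub>+\<^sub>1 - x\<^sup>2 A\<^sub>m\<close>.
  For \<open>m \<ge> 2\<close>, induction gives \<open>R\<^sub>2\<^sub>m = A\<^sub>m - A\<^sub>m\<^sub>-\<^sub>1 + A\<^sub>m\<^sub>-\<^sub>2\<close> and
  \<open>R\<^sub>2\<^sub>m\<^sub>+\<^sub>1 = (1 + x) A\<^sub>m - (x + x\<^sup>2) A\<^sub>m\<^sub>-\<^sub>1\<close>.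
\<close>

section \<open>Filters and their rank generating polynomials\<close>

text \<open>Closure propagates along chains of generators, so single steps suffice. Only
  \<open>b \<le> n\<close> has to be asked: \<open>a\<close> lies in the carrier because it lies in
  \<open>Y\<close>.\<close>

lemma S_fence_filters_iff:
  "Y \<in> S_fence_filters n \<longleftrightarrow>
     Y \<subseteq> {1..n} \<and> (\<forall>a b. (a, b) \<in> S_fence_gen \<longrightarrow> a \<in> Y \<longrightarrow> b \<le> n \<longrightarrow> b \<in> Y)"
  (is "?L \<longleftrightarrow> ?R")
proof
  assume L: ?L
  have "b \<in> Y" if "(a, b) \<in> S_fence_gen" "a \<in> Y" "b \<le> n" for a b
  proof -
    have "a \<in> {1..n}" "b \<in> {1..n}"
      using L that unfolding S_fence_filters_def S_fence_gen_def by auto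
    then have "(a, b) \<in> S_fence_order n"
      using that unfolding S_fence_order_def S_fence_cover_def by auto
    then show ?thesis
      using L that unfolding S_fence_filters_def by blast
  qed
  then show ?R
    using L unfolding S_fence_filters_def by blast
next
  assume R: ?R
  have "b \<in> Y" if "(a, b) \<in> (S_fence_cover n)\<^sup>*" "a \<in> Y" for a b
    using that by (induction rule: rtrancl_induct) (use R in \<open>auto simp: S_fence_cover_def\<close>)
  then show ?L
    using R unfolding S_fence_filters_def S_fence_order_def by blast
qed

lemma finite_S_fence_filters [simp]: "finite (S_fence_filters n)"
  by (rule finite_subset[of _ "Pow {1..n}"]) (auto simp: S_fence_filters_def)

lemma S_fence_filters_bound: "Y \<in> S_fence_filters n \<Longrightarrow> x \<in> Y \<Longrightarrow> 0 < x \<and> x \<le> n"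
  by (auto simp: S_fence_filters_def)

definition rank_poly :: "nat \<Rightarrow> int poly" where
  "rank_poly n = (\<Sum>Y\<in>S_fence_filters n. monom 1 (filter_rank n Y))"

lemma coeff_rank_poly: "coeff (rank_poly n) k = int (rank_number n k)"
proof -
  have "coeff (rank_poly n) k =
      (\<Sum>Y\<in>S_fence_filters n. if filter_rank n Y = k then 1 else 0)"
    unfolding rank_poly_def coeff_sum by (auto intro!: sum.cong)
  also have "\<dots> = int (rank_number n k)"
    unfolding rank_number_def by (simp add: sum.If_cases Int_def)
  finally show ?thesis .
qed

text \<open>Disjointness from \<open>Z\<close> makes the union injective and cardinalities additive,
  so every rank shifts by \<open>c\<close>. Both halves of \<open>rank_poly_split\<close> are
  instances.\<close>

lemma rank_poly_image:
  assumes "\<And>Y. Y \<in> S_fence_filters p \<Longrightarrow> Y \<inter> Z = {}" and "Z \<subseteq> {1..n}" and "p + card Z + c = n"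
  shows "(\<Sum>Y\<in>(\<lambda>Y. Y \<union> Z) ` S_fence_filters p. monom (1::int) (filter_rank n Y))
    = monom 1 c * rank_poly p"
proof -
  have fin: "finite Z" using assms(2) finite_subset by blast
  have inj: "inj_on (\<lambda>Y. Y \<union> Z) (S_fence_filters p)"
    using assms(1) unfolding inj_on_def by blast
  have "filter_rank n (Y \<union> Z) = c + filter_rank p Y" if "Y \<in> S_fence_filters p" for Y
  proof -
    have Y: "Y \<subseteq> {1..p}" using that by (auto simp: S_fence_filters_def)
    \<comment> \<open>This keeps the truncated subtraction in \<open>filter_rank\<close>
      exact.\<close>
    then have "card Y \<le> p" using card_mono[of "{1..p}" Y] by simp
    moreover have "card (Y \<union> Z) = card Y + card Z"
      using assms(1)[OF that] Y fin finite_subset[OF Y] by (intro card_Un_disjoint) auto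
    ultimately show ?thesis using assms(3) by (simp add: filter_rank_def)
  qed
  then show ?thesis
    unfolding rank_poly_def
    by (simp add: sum.reindex[OF inj] sum_distrib_left mult_monom)
qed

section \<open>Splitting the filters at one element\<close>

lemma S_fence_filters_mem_order:
  "Y \<in> S_fence_filters n \<Longrightarrow> a \<in> Y \<Longrightarrow> (a, b) \<in> S_fence_order n \<Longrightarrow> b \<in> Y"
  by (auto simp: S_fence_filters_def)

lemma S_fence_gen_order:
  "(a, b) \<in> S_fence_gen \<Longrightarrow> a \<le> n \<Longrightarrow> b \<le> n \<Longrightarrow> (a, b) \<in> S_fence_order n"
  by (auto simp: S_fence_order_def S_fence_cover_def S_fence_gen_def)

lemma S_fence_order_refl: "0 < a \<Longrightarrow> a \<le> n \<Longrightarrow> (a, a) \<in> S_fence_order n"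
  by (simp add: S_fence_order_def)

lemma S_fence_order_trans:
  "(a, b) \<in> S_fence_order n \<Longrightarrow> (b, c) \<in> S_fence_order n \<Longrightarrow> (a, c) \<in> S_fence_order n"
  by (auto simp: S_fence_order_def)

text \<open>The hypotheses say that the principal filter of \<open>t\<close> is \<open>{p<..n}\<close> and its principal ideal is
  \<open>{q<..n}\<close>: a filter containing \<open>t\<close> is determined by its restriction to \<open>\<phi>\<^sub>p\<close>, and one
  avoiding \<open>t\<close> is a filter of \<open>\<phi>\<^sub>q\<close>.\<close>

lemma rank_poly_split:
  assumes t: "p < t" "q < t" "t \<le> n"
    and up: "\<And>x. p < x \<Longrightarrow> x \<le> n \<Longrightarrow> (t, x) \<in> S_fence_order n"
    and up_closed: "\<And>a b. (a, b) \<in> S_fence_gen \<Longrightarrow> p < a \<Longrightarrow> b \<le> n \<Longrightarrow> p < b"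
    and down: "\<And>x. q < x \<Longrightarrow> x \<le> n \<Longrightarrow> (x, t) \<in> S_fence_order n"
    and down_closed: "\<And>a b. (a, b) \<in> S_fence_gen \<Longrightarrow> q < b \<Longrightarrow> b \<le> n \<Longrightarrow> q < a"
  shows "rank_poly n = rank_poly p + monom 1 (n - q) * rank_poly q"
proof -
  let ?Z = "{p<..n}"
  have disj: "Y \<inter> ?Z = {}" if "Y \<in> S_fence_filters p" for Y
    using S_fence_filters_bound[OF that] by fastforce
  have "S_fence_filters n = (\<lambda>Y. Y \<union> ?Z) ` S_fence_filters p \<union> S_fence_filters q"
  proof (intro Set.equalityI subsetI)
    fix Y assume Y: "Y \<in> S_fence_filters n"
    show "Y \<in> (\<lambda>Y. Y \<union> ?Z) ` S_fence_filters p \<union> S_fence_filters q"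
    proof (cases "t \<in> Y")
      case True
      then have "?Z \<subseteq> Y"
        using S_fence_filters_mem_order[OF Y] up by auto
      moreover have "Y - ?Z \<in> S_fence_filters p"
        using Y t unfolding S_fence_filters_iff by fastforce
      ultimately show ?thesis
        by (intro UnI1 image_eqI[of _ _ "Y - ?Z"]) auto
    next
      case False
      \<comment> \<open>An index beyond \<open>q\<close> lies below \<open>t\<close> in the order
        and would force \<open>t\<close> into \<open>Y\<close>.\<close>
      have "x \<le> q" if "x \<in> Y" for x
        using False S_fence_filters_mem_order[OF Y that] down S_fence_filters_bound[OF Y that]
        by (metis not_le)
      then have "Y \<in> S_fence_filters q"
        using Y t unfolding S_fence_filters_iff by fastforce
      then show ?thesis by blast
    qed
  next
    fix Y assume "Y \<in> (\<lambda>Y. Y \<union> ?Z) ` S_fence_filters p \<union> S_fence_filters q"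
    then consider X where "X \<in> S_fence_filters p" "Y = X \<union> ?Z" | "Y \<in> S_fence_filters q"
      by blast
    then show "Y \<in> S_fence_filters n"
    proof cases
      case 1
      \<comment> \<open>If \<open>p < b\<close>, then \<open>b\<close> is in the added block.
        Otherwise \<open>up_closed\<close> gives \<open>a \<le> p\<close>, so \<open>a\<close> is in
        \<open>X\<close>, and so is \<open>b\<close>.\<close>
      have "b \<in> Y" if "(a, b) \<in> S_fence_gen" "a \<in> Y" "b \<le> n" for a b
        using 1 that up_closed[of a b] unfolding S_fence_filters_iff
        by (cases "p < b") (auto simp: not_less)
      then show ?thesis
        using 1 t unfolding S_fence_filters_iff by force
    next
      case 2
      \<comment> \<open>Here \<open>a \<le> q\<close>, so \<open>down_closed\<close> excludes
        \<open>q < b\<close>.\<close>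
      have "b \<in> Y" if "(a, b) \<in> S_fence_gen" "a \<in> Y" "b \<le> n" for a b
        using 2 that down_closed[of a b] S_fence_filters_bound[OF 2 that(2)]
        unfolding S_fence_filters_iff by (cases "q < b") (auto simp: not_less)
      then show ?thesis
        using 2 t unfolding S_fence_filters_iff by force
    qed
  qed
  \<comment> \<open>Only members of the first family contain \<open>t\<close>.\<close>
  moreover have "(\<lambda>Y. Y \<union> ?Z) ` S_fence_filters p \<inter> S_fence_filters q = {}"
    using t S_fence_filters_bound by fastforce
  moreover have "(\<Sum>Y\<in>(\<lambda>Y. Y \<union> ?Z) ` S_fence_filters p. monom (1::int) (filter_rank n Y))
      = rank_poly p"
    using t by (subst rank_poly_image[OF disj, where c = 0]) auto
  moreover have "(\<Sum>Y\<in>S_fence_filters q. monom (1::int) (filter_rank n Y))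
      = monom 1 (n - q) * rank_poly q"
    using rank_poly_image[of q "{}" n "n - q"] t by simp
  ultimately show ?thesis
    unfolding rank_poly_def[of n] by (simp add: sum.union_disjoint)
qed

section \<open>Recurrences and initial values of the rank polynomials\<close>

text \<open>The pair \<open>(5, 4)\<close> is absorbed into the family \<open>a = b + 1\<close> by
  lowering its bound to 4. Parity in place of a witness \<open>i\<close> leaves goals that
  \<open>presburger\<close> decides.\<close>

lemma S_fence_gen_cases:
  assumes "(a, b) \<in> S_fence_gen"
  obtains "a = 2" "b = 1" | "a = 3" "b = 2" | "a = 2" "b = 4"
    | "even b" "4 \<le> b" "a = b + 1" | "even b" "6 \<le> b" "b = a + 1"
  using assms unfolding S_fence_gen_def by force

text \<open>The element \<open>2 * m + 1\<close> is minimal, and only \<open>2 * m\<close> lies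
  strictly above it.\<close>

lemma rank_poly_odd:
  assumes "m \<ge> 2"
  shows "rank_poly (2 * m + 1) = rank_poly (2 * m - 1) + monom 1 1 * rank_poly (2 * m)"
proof -
  have gen: "(2 * m + 1, 2 * m) \<in> S_fence_gen"
    using assms unfolding S_fence_gen_def by (cases "m = 2") auto
  have "rank_poly (2 * m + 1) =
      rank_poly (2 * m - 1) + monom 1 (2 * m + 1 - 2 * m) * rank_poly (2 * m)"
  proof (rule rank_poly_split[of _ "2 * m + 1"])
    show "(2 * m + 1, x) \<in> S_fence_order (2 * m + 1)" if "2 * m - 1 < x" "x \<le> 2 * m + 1" for x
    proof -
      have "x = 2 * m \<or> x = 2 * m + 1" using that by linarith
      then show ?thesis using S_fence_gen_order[OF gen] S_fence_order_refl by auto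
    qed
    show "(x, 2 * m + 1) \<in> S_fence_order (2 * m + 1)" if "2 * m < x" "x \<le> 2 * m + 1" for x
      using that S_fence_order_refl[of x] by (simp add: le_Suc_eq)
    fix a b assume ab: "(a, b) \<in> S_fence_gen" "b \<le> 2 * m + 1"
    show "2 * m - 1 < b" if "2 * m - 1 < a"
      using ab(1) by (cases rule: S_fence_gen_cases) (use that ab(2) assms in presburger)+
    show "2 * m < a" if "2 * m < b"
      using ab(1) by (cases rule: S_fence_gen_cases) (use that ab(2) assms in presburger)+
  qed (use assms in auto)
  then show ?thesis by simp
qed

text \<open>The element \<open>2 * m\<close> is maximal, and only \<open>2 * m - 1\<close> lies
  strictly below it. This fails for \<open>m = 2\<close>, where 2 and 3 both lie below 4; see
  \<open>rank_poly_4\<close>.\<close>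

lemma rank_poly_even:
  assumes "m \<ge> 3"
  shows "rank_poly (2 * m) = rank_poly (2 * m - 1) + monom 1 2 * rank_poly (2 * m - 2)"
proof -
  have gen: "(2 * m - 1, 2 * m) \<in> S_fence_gen"
    using assms unfolding S_fence_gen_def by auto
  have "rank_poly (2 * m) =
      rank_poly (2 * m - 1) + monom 1 (2 * m - (2 * m - 2)) * rank_poly (2 * m - 2)"
  proof (rule rank_poly_split[of _ "2 * m"])
    show "(2 * m, x) \<in> S_fence_order (2 * m)" if "2 * m - 1 < x" "x \<le> 2 * m" for x
    proof -
      have "x = 2 * m" using that by linarith
      then show ?thesis using assms S_fence_order_refl by auto
    qed
    show "(x, 2 * m) \<in> S_fence_order (2 * m)" if "2 * m - 2 < x" "x \<le> 2 * m" for x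
    proof -
      have "x = 2 * m \<or> x = 2 * m - 1" using that by linarith
      then show ?thesis using assms S_fence_gen_order[OF gen] S_fence_order_refl by auto
    qed
    fix a b assume ab: "(a, b) \<in> S_fence_gen" "b \<le> 2 * m"
    show "2 * m - 1 < b" if "2 * m - 1 < a"
      using ab(1) by (cases rule: S_fence_gen_cases) (use that ab(2) assms in presburger)+
    show "2 * m - 2 < a" if "2 * m - 2 < b"
      using ab(1) by (cases rule: S_fence_gen_cases) (use that ab(2) assms in presburger)+
  qed (use assms in auto)
  then show ?thesis using assms by simp
qed

lemma rank_poly_0: "rank_poly 0 = 1"
proof -
  have "S_fence_filters 0 = {{}}" by (auto simp: S_fence_filters_iff S_fence_gen_def)
  then show ?thesis by (simp add: rank_poly_def filter_rank_def)
qed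

lemma S_fence_order_start: "2 \<le> n \<Longrightarrow> (2, 1) \<in> S_fence_order n"
  "3 \<le> n \<Longrightarrow> (3, 2) \<in> S_fence_order n" "4 \<le> n \<Longrightarrow> (2, 4) \<in> S_fence_order n"
  by (auto intro!: S_fence_gen_order simp: S_fence_gen_def)

text \<open>Up to \<open>n = 3\<close> the fence is a chain with \<open>n\<close> at the bottom, so
  the only filter containing \<open>n\<close> is the full set.\<close>

lemma rank_poly_chain:
  assumes "n \<in> {1, 2, 3}"
  shows "rank_poly n = rank_poly 0 + monom 1 1 * rank_poly (n - 1)"
proof -
  have "rank_poly n = rank_poly 0 + monom 1 (n - (n - 1)) * rank_poly (n - 1)"
  proof (rule rank_poly_split[of _ n])
    fix x assume "0 < x" "x \<le> n"
    then have "x = n \<or> x = 2 \<and> n = 3 \<or> x = 1 \<and> n = 2 \<or> x = 1 \<and> n = 3" using assms by auto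
    then show "(n, x) \<in> S_fence_order n"
      using assms S_fence_order_start[of n] S_fence_order_refl[of n n]
        S_fence_order_trans[of 3 2 n 1] by auto
  next
    show "(x, n) \<in> S_fence_order n" if "n - 1 < x" "x \<le> n" for x
      using that S_fence_order_refl[of n n] by (cases "x = n") auto
  qed (use assms in \<open>auto simp: S_fence_gen_def\<close>)
  then show ?thesis using assms by auto
qed

text \<open>The element 4 is maximal and lies above 2 and 3 but not above 1, hence the shift by
  3.\<close>

lemma rank_poly_4: "rank_poly 4 = rank_poly 3 + monom 1 3 * rank_poly 1"
proof -
  have "rank_poly 4 = rank_poly 3 + monom 1 (4 - 1) * rank_poly 1"
  proof (rule rank_poly_split[of _ 4])
    show "(4, x) \<in> S_fence_order 4" if "3 < x" "x \<le> 4" for x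
      using that S_fence_order_refl[of 4 4] by (cases "x = 4") auto
    show "(x, 4) \<in> S_fence_order 4" if "1 < x" "x \<le> 4" for x
    proof -
      have "x = 2 \<or> x = 3 \<or> x = 4" using that by linarith
      then show ?thesis
        using S_fence_order_start[of 4] S_fence_order_refl[of 4 4]
          S_fence_order_trans[of 3 2 4 4] by auto
    qed
  qed (auto simp: S_fence_gen_def)
  then show ?thesis by simp
qed

section \<open>The Chebyshev-like polynomials and their coefficients\<close>

text \<open>With \<open>T = [:1, 1, 1:]\<close> this is x^m U_m(T / (2x)), where U_m is the
  Chebyshev polynomial of the second kind. Terms with \<open>2 * i > m\<close> have binomial 0;
  summing up to \<open>m\<close> avoids parity cases when indices shift.\<close>

definition cheb :: "nat \<Rightarrow> int poly" where
  "cheb m = (\<Sum>i\<le>m. smult ((-1) ^ i * int ((m - i) choose i))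
     (monom 1 (2 * i) * [:1, 1, 1:] ^ (m - 2 * i)))"

lemma cheb_0: "cheb 0 = 1" and cheb_1: "cheb (Suc 0) = [:1, 1, 1:]"
  by (simp_all add: cheb_def binomial_eq_0)

lemma cheb_rec: "cheb (m + 2) = [:1, 1, 1:] * cheb (m + 1) - monom 1 2 * cheb m"
proof -
  define T :: "int poly" where "T = [:1, 1, 1:]"
  define t where "t = (\<lambda>m i. smult ((-1) ^ i * int ((m - i) choose i))
     (monom 1 (2 * i) * T ^ (m - 2 * i)))"
  have cheb: "cheb l = (\<Sum>i\<le>l. t l i)" for l
    unfolding cheb_def t_def T_def ..
  have t0: "t (m + 2) 0 = T * t (m + 1) 0"
    by (simp add: t_def)
  \<comment> \<open>All three terms are multiples of one polynomial \<open>P\<close>, and their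
    scalars are related by Pascal's rule.\<close>
  have tS: "t (m + 2) (Suc i) = T * t (m + 1) (Suc i) - monom 1 2 * t m i" if "i \<le> m" for i
  proof -
    define P where "P = monom 1 (2 * Suc i) * T ^ (m - 2 * i)"
    have P2: "monom 1 2 * (monom 1 (2 * i) * T ^ (m - 2 * i)) = P"
      by (simp add: P_def mult_monom flip: mult.assoc)
    have "T * smult (int ((m - i) choose Suc i))
         (monom 1 (2 * Suc i) * T ^ (m + 1 - 2 * Suc i)) = smult (int ((m - i) choose Suc i)) P"
    \<comment> \<open>For \<open>m \<le> 2 * i\<close> the truncated exponent spoils the powers of
      \<open>T\<close>, but the binomial is 0.\<close>
    proof (cases "2 * i < m")
      case True
      then have "m - 2 * i = Suc (m + 1 - 2 * Suc i)" by simp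
      then show ?thesis by (simp add: P_def mult_ac)
    qed (simp add: binomial_eq_0)
    then have "T * t (m + 1) (Suc i) = smult ((-1) ^ Suc i * int ((m - i) choose Suc i)) P"
      unfolding t_def by (simp flip: smult_smult)
    moreover have "monom 1 2 * t m i = smult ((-1) ^ i * int ((m - i) choose i)) P"
      unfolding t_def by (simp add: P2)
    moreover have "t (m + 2) (Suc i) =
        smult ((-1) ^ Suc i * int (Suc (m - i) choose Suc i)) P"
      using that unfolding t_def P_def by (simp add: Suc_diff_le)
    moreover have "(-1) ^ Suc i * int (Suc (m - i) choose Suc i) =
        (-1) ^ Suc i * int ((m - i) choose Suc i) - (-1) ^ i * int ((m - i) choose i)"
      by (simp add: algebra_simps)
    ultimately show ?thesis
      by (simp only: smult_diff_left)
  qed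
  have top: "t (m + 2) (Suc (Suc m)) = 0"
    by (simp add: t_def)
  have "cheb (m + 2) = t (m + 2) 0 + (\<Sum>i\<le>m. t (m + 2) (Suc i))"
    using top unfolding cheb add_2_eq_Suc' sum.atMost_Suc_shift[of _ "Suc m"]
    by (simp only: sum.atMost_Suc add_0_right)
  also have "\<dots> = T * (t (m + 1) 0 + (\<Sum>i\<le>m. t (m + 1) (Suc i))) - monom 1 2 * (\<Sum>i\<le>m. t m i)"
    using t0 tS by (simp add: sum_subtractf sum_distrib_left distrib_left)
  also have "t (m + 1) 0 + (\<Sum>i\<le>m. t (m + 1) (Suc i)) = cheb (m + 1)"
    unfolding cheb by (simp add: sum.atMost_Suc_shift del: sum.atMost_Suc)
  finally show ?thesis
    unfolding cheb T_def .
qed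

text \<open>The factor \<open>monom 1 s\<close> produces the shifted lower arguments of the odd
  formula. When \<open>k < s + 2 * i\<close> both sides contribute 0, since \<open>trinomial\<close>
  vanishes at negative arguments.\<close>

lemma coeff_monom_cheb:
  "coeff (monom 1 s * cheb m) k = (\<Sum>i\<le>m div 2.
     (-1) ^ i * int ((m - i) choose i) * trinomial (m - 2 * i) (int k - 2 * int i - int s))"
proof -
  have "coeff (monom 1 s * cheb m) k = (\<Sum>i\<le>m.
     (-1) ^ i * int ((m - i) choose i) * trinomial (m - 2 * i) (int k - 2 * int i - int s))"
    unfolding cheb_def sum_distrib_left coeff_sum
  proof (rule sum.cong)
    fix i
    have "monom 1 s * (monom 1 (2 * i) * p) = monom 1 (s + 2 * i) * p" for p :: "int poly"
      by (simp add: mult_monom flip: mult.assoc)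
    moreover have "nat (int k - 2 * int i - int s) = k - (s + 2 * i)" by simp
    ultimately show "coeff (monom 1 s * smult ((-1) ^ i * int ((m - i) choose i))
        (monom 1 (2 * i) * [:1, 1, 1:] ^ (m - 2 * i))) k =
      (-1) ^ i * int ((m - i) choose i) * trinomial (m - 2 * i) (int k - 2 * int i - int s)"
      by (simp add: trinomial_def coeff_monom_mult)
  qed simp
  also have "\<dots> = (\<Sum>i\<le>m div 2.
     (-1) ^ i * int ((m - i) choose i) * trinomial (m - 2 * i) (int k - 2 * int i - int s))"
    by (rule sum.mono_neutral_right) (auto simp: binomial_eq_0)
  finally show ?thesis .
qed

section \<open>Closed forms of the rank polynomials and comparison of coefficients\<close>

lemma monom_as_power: "monom (1::int) n = [:0, 1:] ^ n"
  by (simp add: monom_altdef)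

lemma rank_poly_1: "rank_poly 1 = 1 + [:0, 1:]"
  using rank_poly_chain[of 1] by (simp add: rank_poly_0 monom_as_power)

lemma rank_poly_2: "rank_poly 2 = 1 + [:0, 1:] + [:0, 1:]\<^sup>2"
  using rank_poly_chain[of 2] rank_poly_1
  by (simp add: rank_poly_0 monom_as_power power2_eq_square one_pCons)

text \<open>Each recurrence involves both parities, so the two formulas are proved together. Keeping
  \<open>X\<close> opaque turns every step into a commutative ring identity for
  \<open>algebra\<close>.\<close>

lemma rank_poly_cheb:
  fixes X :: "int poly"
  defines "X \<equiv> [:0, 1:]"
  shows "rank_poly (2 * m + 4) = cheb (m + 2) - cheb (m + 1) + cheb m \<and>
    rank_poly (2 * m + 5) = (1 + X) * cheb (m + 2) - (X + X\<^sup>2) * cheb (m + 1)"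
proof (induction m)
  case 0
  have "rank_poly 1 = 1 + X" "rank_poly 2 = 1 + X + X\<^sup>2" "rank_poly 3 = 1 + X * rank_poly 2"
    "rank_poly 4 = rank_poly 3 + X ^ 3 * rank_poly 1" "rank_poly 5 = rank_poly 3 + X * rank_poly 4"
    using rank_poly_1 rank_poly_2 rank_poly_chain[of 3] rank_poly_4 rank_poly_odd[of 2]
    unfolding monom_as_power X_def[symmetric] by (simp_all add: rank_poly_0)
  moreover have "cheb 1 = 1 + X + X\<^sup>2"
    by (simp add: cheb_1 X_def power2_eq_square one_pCons)
  moreover have "cheb 2 = (1 + X + X\<^sup>2)\<^sup>2 - X\<^sup>2"
    using cheb_rec[of 0] unfolding numeral_2_eq_2
    by (simp add: cheb_0 cheb_1 X_def one_pCons monom_altdef)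
  ultimately have "rank_poly 4 = cheb 2 - cheb 1 + cheb 0"
    "rank_poly 5 = (1 + X) * cheb 2 - (X + X\<^sup>2) * cheb 1"
    unfolding cheb_0 by algebra+
  then show ?case by (simp add: numeral_2_eq_2)
next
  case (Suc m)
  have T: "[:1, 1, 1:] = 1 + X + X\<^sup>2"
    by (simp add: X_def power2_eq_square one_pCons)
  have c: "cheb (m + 3) = (1 + X + X\<^sup>2) * cheb (m + 2) - X\<^sup>2 * cheb (m + 1)"
    "cheb (m + 2) = (1 + X + X\<^sup>2) * cheb (m + 1) - X\<^sup>2 * cheb m"
    using cheb_rec[of "m + 1"] cheb_rec[of m] unfolding T monom_as_power X_def[symmetric]
    by (simp_all add: numeral_3_eq_3)
  have r: "rank_poly (2 * m + 6) = rank_poly (2 * m + 5) + X\<^sup>2 * rank_poly (2 * m + 4)"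
    "rank_poly (2 * m + 7) = rank_poly (2 * m + 5) + X * rank_poly (2 * m + 6)"
    using rank_poly_even[of "m + 3"] rank_poly_odd[of "m + 3"]
    unfolding monom_as_power X_def[symmetric] by (simp_all add: algebra_simps)
  have even: "rank_poly (2 * m + 6) = cheb (m + 3) - cheb (m + 2) + cheb (m + 1)"
    using r(1) c Suc.IH by algebra
  moreover have "rank_poly (2 * m + 7) = (1 + X) * cheb (m + 3) - (X + X\<^sup>2) * cheb (m + 2)"
    using r(2) even c(1) Suc.IH by algebra
  ultimately show ?case by (simp add: algebra_simps numeral_3_eq_3)
qed

lemma atMost_div2_int: "{i::nat. int i \<le> int m div 2} = {..m div 2}"
  by auto

theorem theorem2:
  fixes m k :: nat
  shows
    "int (rank_number (2 * m) k) =
       (if m = 1 \<and> k = 0 then 1 else 0)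
       + (\<Sum>i::nat | int i \<le> int m div 2.
            (-1) ^ i * int ((m - i) choose i) * trinomial (m - 2 * i) (int k - 2 * int i))
       - (\<Sum>i::nat | int i \<le> (int m - 1) div 2.
            (-1) ^ i * int ((m - i - 1) choose i) * trinomial (m - 2 * i - 1) (int k - 2 * int i))
       + (\<Sum>i::nat | int i \<le> (int m - 2) div 2.
            (-1) ^ i * int ((m - i - 2) choose i) * trinomial (m - 2 * i - 2) (int k - 2 * int i))
     \<and>
     int (rank_number (2 * m + 1) k) =
       (\<Sum>i::nat | int i \<le> int m div 2.
            (-1) ^ i * int ((m - i) choose i)
            * (trinomial (m - 2 * i) (int k - 2 * int i)
               + trinomial (m - 2 * i) (int k - 2 * int i - 1)))
       - (\<Sum>i::nat | int i \<le> (int m - 1) div 2.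
            (-1) ^ i * int ((m - i - 1) choose i)
            * (trinomial (m - 2 * i - 1) (int k - 2 * int i - 1)
               + trinomial (m - 2 * i - 1) (int k - 2 * int i - 2)))"
proof -
  have conv: "(\<Sum>i | int i \<le> int m div 2. f i) = (\<Sum>i\<le>m div 2. f i)"
    for f :: "nat \<Rightarrow> int" and m
    by (simp add: atMost_div2_int)
  consider "m = 0" | "m = 1" | m' where "m = m' + 2"
    by (metis add_2_eq_Suc' not0_implies_Suc One_nat_def)
  then show ?thesis
  proof cases
    case 1
    \<comment> \<open>The remaining sums are empty: integer division makes their upper limits
      negative. The factor \<open>monom 1 0\<close> only fits the shape of
      \<open>coeff_monom_cheb\<close>.\<close>
    have even: "rank_poly (2 * m) = monom 1 0 * cheb 0"
      and odd: "rank_poly (2 * m + 1) = monom 1 0 * cheb 0 + monom 1 1 * cheb 0"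
      using 1 rank_poly_1 by (simp_all add: rank_poly_0 cheb_0 monom_altdef one_pCons)
    show ?thesis
      unfolding coeff_rank_poly[symmetric] even odd coeff_add coeff_monom_cheb using 1
      by (simp add: flip: atMost_div2_int)
  next
    case 2
    \<comment> \<open>The extra 1 is the Kronecker delta term; the third sum is empty.\<close>
    have even: "rank_poly (2 * m) = 1 + monom 1 0 * cheb 1 - monom 1 0 * cheb 0"
      and odd: "rank_poly (2 * m + 1) =
        monom 1 0 * cheb 1 + monom 1 1 * cheb 1 - (monom 1 1 * cheb 0 + monom 1 2 * cheb 0)"
      using 2 rank_poly_2 rank_poly_2[unfolded numeral_2_eq_2] rank_poly_chain[of 3]
      by (simp_all add: rank_poly_0 cheb_0 cheb_1 monom_altdef power2_eq_square one_pCons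
          numeral_3_eq_3)
    show ?thesis
      unfolding coeff_rank_poly[symmetric] even odd coeff_add coeff_diff coeff_monom_cheb using 2
      by (simp add: flip: atMost_div2_int)
  next
    case 3
    define X :: "int poly" where "X = [:0, 1:]"
    have idx: "2 * m' + 4 = 2 * m" "2 * m' + 5 = 2 * m + 1" "m' + 2 = m" "m' + 1 = m - 1" "m' = m - 2"
      using 3 by auto
    have even: "rank_poly (2 * m) =
        monom 1 0 * cheb m - monom 1 0 * cheb (m - 1) + monom 1 0 * cheb (m - 2)"
      and odd: "rank_poly (2 * m + 1) =
        monom 1 0 * cheb m + monom 1 1 * cheb m - (monom 1 1 * cheb (m - 1) + monom 1 2 * cheb (m - 1))"
      using rank_poly_cheb[of m', unfolded idx(1-4), folded X_def]
      unfolding monom_as_power X_def[symmetric] by (simp_all add: idx(5) algebra_simps)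
    \<comment> \<open>Since \<open>m \<ge> 2\<close>, the integer limits agree with the natural
      ones, and the sums become those for \<open>m - 1\<close> and \<open>m - 2\<close>.\<close>
    have sub: "int m - 1 = int (m - 1)" "int m - 2 = int (m - 2)"
      "\<And>i. m - i - 1 = m - 1 - i" "\<And>i. m - i - 2 = m - 2 - i"
      "\<And>i. m - 2 * i - 1 = m - 1 - 2 * i" "\<And>i. m - 2 * i - 2 = m - 2 - 2 * i"
      using 3 by auto
    show ?thesis
      unfolding coeff_rank_poly[symmetric] even odd coeff_add coeff_diff coeff_monom_cheb
        sub conv using 3
      by (simp add: distrib_left sum.distrib)
  qed
qed

end
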